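(* Let $L : M_n(\mathbb{R}) \to M_n(\mathbb{R})$ be a linear map that is an onto preserver of Schur stability, i.e. $L(\mathcal{S}) = \mathcal{S}$, where $\mathcal{S} \subseteq M_n(\mathbb{R})$ is the set of Schur stable matrices. Then $L$ preserves the spectral radius, that is, $\rho(A) = \rho(L(A))$ for all $A \in M_n(\mathbb{R})$.
   Context: $M_n(\mathbb{R})$ is the real vector space of $n \times n$ real matrices. A matrix $A \in M_n(\mathbb{R})$ is Schur stable if all its (complex) eigenvalues lie in the open unit disc. For $A \in M_n(\mathbb{R})$, $\rho(A)$ denotes the spectral radius, i.e. the maximum of $|\lambda|$ over all (complex) eigenvalues $\lambda$ of $A$. *)

theory Defs
  imports "Jordan_Normal_Form.Spectral_Radius"
begin

text \<open>Real matrices have complex eigenvalues: \<^const>\<open>spectrum\<close> and \<^const>\<open>spectral_radius\<close> are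
  always taken after embedding the entries into the complex numbers.\<close>

abbreviation cmat :: "real mat \<Rightarrow> complex mat" where
  "cmat A \<equiv> map_mat complex_of_real A"

definition schur_stable :: "real mat \<Rightarrow> bool" where
  "schur_stable A \<longleftrightarrow> (\<forall>z \<in> spectrum (cmat A). cmod z < 1)"

definition schur_stable_mats :: "nat \<Rightarrow> real mat set" where
  "schur_stable_mats n = {A \<in> carrier_mat n n. schur_stable A}"

text \<open>The vector space of real \<open>n \<times> n\<close> matrices is \<^term>\<open>module_mat TYPE(real) n n\<close>. A map \<open>L\<close> on it is
  a function on the type of all real matrices of which only the values on \<^term>\<open>carrier_mat n n\<close>
  matter, and \<^const>\<open>linear_map\<close> amounts to the following conditions.\<close>

lemma linear_map_module_mat_iff:
  "linear_map class_ring (module_mat TYPE(real) n n) (module_mat TYPE(real) n n) L \<longleftrightarrow>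
     L \<in> carrier_mat n n \<rightarrow> carrier_mat n n \<and>
     (\<forall>A\<in>carrier_mat n n. \<forall>B\<in>carrier_mat n n. L (A + B) = L A + L B) \<and>
     (\<forall>c. \<forall>A\<in>carrier_mat n n. L (c \<cdot>\<^sub>m A) = c \<cdot>\<^sub>m L A)"
proof -
  interpret V: vectorspace class_ring "module_mat TYPE(real) n n"
    by (rule matrix_vs)
  have "linear_map class_ring (module_mat TYPE(real) n n) (module_mat TYPE(real) n n) L \<longleftrightarrow>
      L \<in> module_hom class_ring (module_mat TYPE(real) n n) (module_mat TYPE(real) n n)"
    unfolding linear_map_def mod_hom_def mod_hom_axioms_def
    using V.vectorspace_axioms V.module_axioms by blast
  then show ?thesis
    by (auto simp: module_hom_def module_mat_simps Pi_iff)
qed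

end

theory Submission
  imports Defs
begin

text \<open>Positive multiples of Schur stable matrices exhaust the matrix space, so \<open>L\<close> is onto and, by
  finite dimensionality, injective. Hence \<open>A\<close> is Schur stable if and only if \<open>L A\<close> is. Applied to all
  positive multiples of \<open>A\<close>, this determines the spectral radius, because \<open>t A\<close> is Schur stable exactly
  when \<open>t \<rho>(A) < 1\<close>.\<close>

text \<open>Linear independence means the same in \<open>U\<close> as in \<open>V\<close>, so
  \<open>dim\<close> bounds the size of every independent subset of \<open>U\<close>. Starting from
  the empty set, a maximal one therefore exists, and it is a finite basis of
  \<open>U\<close>.\<close>

lemma (in vectorspace) subspace_fin_dim:
  assumes "fin_dim" and U: "subspace K U V"
  shows "vectorspace.fin_dim K (vs U)"
proof -
  interpret U: vectorspace K "vs U"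
    by (rule subspace_is_vs[OF U])
  have sub: "submodule K U V" and UV: "U \<subseteq> carrier V"
    using U by (auto simp: subspace_def submodule_def)
  have "finite A \<and> card A \<le> dim" if "A \<subseteq> carrier (vs U) \<and> U.lin_indpt A" for A
    using that li_le_dim[OF \<open>fin_dim\<close>, of A] span_li_not_depend(2)[OF _ sub, of A] UV by auto
  moreover have "U.lin_indpt {}"
    unfolding U.lin_dep_def by auto
  ultimately obtain A where "finite A" "maximal A (\<lambda>S. S \<subseteq> carrier (vs U) \<and> U.lin_indpt S)"
    using maximal_exists[of "\<lambda>S. S \<subseteq> carrier (vs U) \<and> U.lin_indpt S" dim "{}"] by blast
  then have "finite A" "U.basis A"
    using U.max_li_is_basis by blast+
  then show ?thesis
    unfolding U.fin_dim_def U.basis_def by blast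
qed

text \<open>Rank-nullity: a full image leaves dimension 0 for the kernel. The preceding lemma
  supplies a finite kernel basis, which must then be empty, so the kernel is trivial.\<close>

lemma linear_endo_surj_imp_inj:
  assumes "linear_map K V V T" and fd: "vectorspace.fin_dim K V"
    and surj: "T ` carrier V = carrier V"
  shows "inj_on T (carrier V)"
proof -
  interpret linear_map K V V T by fact
  interpret Ker: vectorspace K "V.vs kerT"
    by (rule V.subspace_is_vs[OF kerT_is_subspace])
  have "vectorspace.dim K (V.vs imT) = V.dim"
    using surj_imp_imT_carrier[OF surj] by simp
  then have "Ker.dim = 0"
    using rank_nullity[OF fd] by simp
  moreover obtain B where B: "finite B" "Ker.basis B"
    using Ker.finite_basis_exists V.subspace_fin_dim[OF fd kerT_is_subspace] by blast
  ultimately have "B = {}"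
    using Ker.dim_basis by simp
  then have "carrier (V.vs kerT) = {\<zero>\<^bsub>V\<^esub>}"
    using B Ker.span_empty by (simp add: Ker.basis_def)
  then show ?thesis
    by (rule Ke0_imp_inj)
qed

text \<open>Finite dimension passes along a surjective linear map, here the one that cuts a vector
  of length \<open>nr * nc\<close> into the rows of a matrix.\<close>

lemma fin_dim_module_mat:
  "vectorspace.fin_dim (class_ring :: 'a :: field ring) (module_mat TYPE('a) nr nc)"
proof -
  let ?V = "module_vec TYPE('a) (nr * nc)" and ?W = "module_mat TYPE('a) nr nc"
  define T :: "'a vec \<Rightarrow> 'a mat" where "T = (\<lambda>v. mat nr nc (\<lambda>(i, j). v $ (i * nc + j)))"
  have idx: "i * nc + j < nr * nc" if "i < nr" "j < nc" for i j
  proof -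
    have "i * nc + j < Suc i * nc" using that by simp
    also have "\<dots> \<le> nr * nc" using that by (intro mult_le_mono1) simp
    finally show ?thesis .
  qed
  interpret V: vec_space "TYPE('a)" "nr * nc" .
  interpret W: vectorspace "class_ring :: 'a ring" ?W
    by (rule matrix_vs)
  have "T \<in> module_hom class_ring ?V ?W"
    by (auto simp: module_hom_def module_mat_simps module_vec_simps T_def idx)
  then interpret T: linear_map "class_ring :: 'a ring" ?V ?W T
    unfolding linear_map_def mod_hom_def mod_hom_axioms_def
    using V.vectorspace_axioms V.module_axioms W.vectorspace_axioms W.module_axioms by blast
  have "A \<in> T ` carrier_vec (nr * nc)" if A: "A \<in> carrier_mat nr nc" for A
  proof
    \<comment> \<open>Division with remainder by \<open>nc\<close> inverts the row-major index
      \<open>i * nc + j\<close>.\<close>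
    show "A = T (vec (nr * nc) (\<lambda>k. A $$ (k div nc, k mod nc)))"
      using A by (intro eq_matI) (auto simp: T_def idx)
  qed auto
  then have "T ` carrier ?V = carrier ?W"
    by (auto simp: module_mat_simps module_vec_simps T_def)
  then show ?thesis
    by (rule T.surj_fin_dim[OF V.fin_dim])
qed

lemma eigenvector_smult:
  fixes A :: "'a :: field mat"
  assumes "A \<in> carrier_mat n n" "eigenvector A v e"
  shows "eigenvector (c \<cdot>\<^sub>m A) v (c * e)"
proof -
  have v: "v \<in> carrier_vec n" "v \<noteq> 0\<^sub>v n" "A *\<^sub>v v = e \<cdot>\<^sub>v v"
    using assms by (auto simp: eigenvector_def)
  have "(c \<cdot>\<^sub>m A) *\<^sub>v v = c \<cdot>\<^sub>v (A *\<^sub>v v)"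
    using assms(1) v(1) by (intro eq_vecI) (auto simp: scalar_prod_def sum_distrib_left mult.assoc)
  then show ?thesis
    using assms(1) v by (auto simp: eigenvector_def smult_smult_assoc)
qed

lemma spectrum_smult:
  fixes A :: "'a :: field mat"
  assumes A: "A \<in> carrier_mat n n" and c: "c \<noteq> 0"
  shows "spectrum (c \<cdot>\<^sub>m A) = (*) c ` spectrum A"
proof
  show "(*) c ` spectrum A \<subseteq> spectrum (c \<cdot>\<^sub>m A)"
    using eigenvector_smult[OF A] by (fastforce simp: spectrum_def eigenvalue_def)
  show "spectrum (c \<cdot>\<^sub>m A) \<subseteq> (*) c ` spectrum A"
  proof
    fix e assume "e \<in> spectrum (c \<cdot>\<^sub>m A)"
    then obtain v where "eigenvector (c \<cdot>\<^sub>m A) v e"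
      by (auto simp: spectrum_def eigenvalue_def)
    \<comment> \<open>The reverse inclusion is the forward one applied to
      \<open>c \<cdot>\<^sub>m A\<close> with the factor \<open>inverse c\<close>.\<close>
    then have "eigenvector (inverse c \<cdot>\<^sub>m (c \<cdot>\<^sub>m A)) v (inverse c * e)"
      using A by (intro eigenvector_smult) auto
    moreover have "inverse c \<cdot>\<^sub>m (c \<cdot>\<^sub>m A) = A"
      using c by (intro eq_matI) auto
    ultimately have "inverse c * e \<in> spectrum A"
      by (auto simp: spectrum_def eigenvalue_def)
    then show "e \<in> (*) c ` spectrum A"
      using c by (intro image_eqI[of _ _ "inverse c * e"]) auto
  qed
qed

text \<open>Scaling by \<open>t\<close> multiplies every eigenvalue modulus by \<open>t\<close>. As
  \<open>n \<ge> 1\<close>, the largest modulus is attained, so a strict bound on all moduli is the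
  same as one on the maximum.\<close>

lemma schur_stable_smult_iff:
  assumes A: "A \<in> carrier_mat n n" and n: "n \<ge> 1" and t: "t > 0"
  shows "schur_stable (t \<cdot>\<^sub>m A) \<longleftrightarrow> t * spectral_radius (cmat A) < 1"
proof -
  have cA: "cmat A \<in> carrier_mat n n" and n0: "0 < n"
    using A n by auto
  have "cmat (t \<cdot>\<^sub>m A) = complex_of_real t \<cdot>\<^sub>m cmat A"
    by (intro eq_matI) auto
  then have "schur_stable (t \<cdot>\<^sub>m A) \<longleftrightarrow> (\<forall>x \<in> norm ` spectrum (cmat A). t * x < 1)"
    using t spectrum_smult[OF cA, of "complex_of_real t"]
    by (simp add: schur_stable_def norm_mult)
  also have "\<dots> \<longleftrightarrow> t * spectral_radius (cmat A) < 1"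
    using spectral_radius_mem_max[OF cA n0] t
    by (meson less_imp_le mult_left_mono order_le_less_trans)
  finally show ?thesis .
qed

lemma spectral_radius_nonneg:
  assumes "A \<in> carrier_mat n n" "n \<ge> 1"
  shows "spectral_radius A \<ge> 0"
  using spectral_radius_mem_max(1)[OF assms(1)] assms(2) by auto

text \<open>If the numbers differed, the larger would be positive, and its reciprocal as
  \<open>t\<close> would give product 1 with the larger but less than 1 with the smaller.\<close>

lemma eq_of_mult_less_one_iff:
  fixes a b :: real
  assumes "a \<ge> 0" "b \<ge> 0" and iff: "\<And>t. t > 0 \<Longrightarrow> t * a < 1 \<longleftrightarrow> t * b < 1"
  shows "a = b"
proof (rule linorder_cases[of a b])
  assume "a < b"
  then show ?thesis
    using iff[of "inverse b"] assms(1) by (simp add: field_simps)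
next
  assume "b < a"
  then show ?thesis
    using iff[of "inverse a"] assms(2) by (simp add: field_simps)
qed

theorem theorem2p15:
  fixes n :: nat and L :: "real mat \<Rightarrow> real mat"
  assumes "n \<ge> 1"
    and "linear_map class_ring (module_mat TYPE(real) n n) (module_mat TYPE(real) n n) L"
    and "L ` schur_stable_mats n = schur_stable_mats n"
  shows "\<forall>A \<in> carrier_mat n n. spectral_radius (cmat A) = spectral_radius (cmat (L A))"
proof -
  let ?M = "carrier_mat n n :: real mat set"
  have L_closed: "L A \<in> ?M" and L_smult: "L (c \<cdot>\<^sub>m A) = c \<cdot>\<^sub>m L A" if "A \<in> ?M" for A c
    using assms(2) that unfolding linear_map_module_mat_iff by auto
  have "B \<in> L ` ?M" if B: "B \<in> ?M" for B
  proof -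
    \<comment> \<open>The summand 1 keeps the denominator positive even for nilpotent
      \<open>B\<close>, and it pushes the spectral radius of \<open>t \<cdot>\<^sub>m B\<close>
      strictly below 1. A preimage of this stable multiple is later scaled back by
      \<open>inverse t\<close>.\<close>
    define t where "t = inverse (spectral_radius (cmat B) + 1)"
    have rho: "spectral_radius (cmat B) \<ge> 0"
      using spectral_radius_nonneg[of "cmat B" n] B assms(1) by simp
    then have t: "t > 0" "t * spectral_radius (cmat B) < 1"
      by (auto simp: t_def field_simps)
    then have "t \<cdot>\<^sub>m B \<in> schur_stable_mats n"
      using B schur_stable_smult_iff[OF B assms(1)] by (simp add: schur_stable_mats_def)
    then obtain A where A: "A \<in> ?M" "t \<cdot>\<^sub>m B = L A"
      using assms(3) by (auto simp: schur_stable_mats_def)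
    have "B = inverse t \<cdot>\<^sub>m (t \<cdot>\<^sub>m B)"
      using t by (intro eq_matI) auto
    also have "\<dots> = L (inverse t \<cdot>\<^sub>m A)"
      using A L_smult by simp
    finally show ?thesis
      using A by auto
  qed
  then have "L ` ?M = ?M"
    using L_closed by auto
  then have inj: "inj_on L ?M"
    using linear_endo_surj_imp_inj[OF assms(2) fin_dim_module_mat] by (simp add: module_mat_simps)
  \<comment> \<open>Stability of \<open>L A\<close> only says that \<open>L A\<close> is the image
    of some stable matrix; injectivity identifies that matrix with \<open>A\<close>.\<close>
  have stable_iff: "schur_stable (L A) \<longleftrightarrow> schur_stable A" if A: "A \<in> ?M" for A
    using inj_on_image_mem_iff[OF inj A, of "schur_stable_mats n"] A L_closed[OF A]
    unfolding assms(3) by (simp add: schur_stable_mats_def subset_eq)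
  show ?thesis
  proof
    fix A assume A: "A \<in> ?M"
    show "spectral_radius (cmat A) = spectral_radius (cmat (L A))"
    proof (rule eq_of_mult_less_one_iff)
      show "spectral_radius (cmat A) \<ge> 0" "spectral_radius (cmat (L A)) \<ge> 0"
        using A L_closed[OF A] assms(1) by (auto intro: spectral_radius_nonneg[of _ n])
      fix t :: real assume "t > 0"
      \<comment> \<open>Both sides express stability, of \<open>t \<cdot>\<^sub>m A\<close> and of
        \<open>t \<cdot>\<^sub>m L A\<close>, and the latter matrix is
        \<open>L (t \<cdot>\<^sub>m A)\<close>.\<close>
      then show "t * spectral_radius (cmat A) < 1 \<longleftrightarrow> t * spectral_radius (cmat (L A)) < 1"
        using schur_stable_smult_iff[OF A assms(1)] schur_stable_smult_iff[OF L_closed[OF A] assms(1)]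
          stable_iff[of "t \<cdot>\<^sub>m A"] L_smult[OF A, of t] A by simp
    qed
  qed
qed

end
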